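(* Let $X$ be a topological space such that the countable power $X^{\omega}$, with the product topology, is countably compact. Then $X$ has bounded cliques; that is, for every closed orthogonality relation $R$ on $X$ there exists a natural number $n$ such that $|A| \leq n$ for every $R$-clique $A \subseteq X$.
   Context: An orthogonality relation on a set $X$ is a symmetric, irreflexive binary relation $R \subseteq X \times X$. If $X$ is a topological space, $R$ is called closed if it is a closed subset of $X \times X$ with the product topology. An $R$-clique is a subset $A \subseteq X$ any two distinct points of which are $R$-related. A space is countably compact if every countable open cover has a finite subcover. No separation axioms are assumed. *)

theory Defs
  imports "HOL-Analysis.Analysis"
begin

text \<open>The library's \<open>countably_compact\<close> is tied to the type class \<open>topological_space\<close>;
  this is its counterpart for abstract topologies.\<close>

definition countably_compact_space :: "'a topology \<Rightarrow> bool" where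
  "countably_compact_space X \<longleftrightarrow>
     (\<forall>\<U>. countable \<U> \<and> (\<forall>U\<in>\<U>. openin X U) \<and> topspace X \<subseteq> \<Union>\<U> \<longrightarrow>
        (\<exists>\<F>. finite \<F> \<and> \<F> \<subseteq> \<U> \<and> topspace X \<subseteq> \<Union>\<F>))"

definition orthogonality_relation :: "'a set \<Rightarrow> ('a \<times> 'a) set \<Rightarrow> bool" where
  "orthogonality_relation S R \<longleftrightarrow> R \<subseteq> S \<times> S \<and> sym R \<and> irrefl R"

definition closed_orthogonality_relation :: "'a topology \<Rightarrow> ('a \<times> 'a) set \<Rightarrow> bool" where
  "closed_orthogonality_relation X R \<longleftrightarrow>
     orthogonality_relation (topspace X) R \<and> closedin (prod_topology X X) R"

definition rel_clique :: "'a set \<Rightarrow> ('a \<times> 'a) set \<Rightarrow> 'a set \<Rightarrow> bool" where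
  "rel_clique S R A \<longleftrightarrow> A \<subseteq> S \<and> pairwise (\<lambda>x y. (x, y) \<in> R) A"

text \<open>Finiteness is required explicitly because \<open>card\<close> is \<open>0\<close> on infinite sets.\<close>

definition bounded_cliques :: "'a topology \<Rightarrow> bool" where
  "bounded_cliques X \<longleftrightarrow>
     (\<forall>R. closed_orthogonality_relation X R \<longrightarrow>
        (\<exists>n::nat. \<forall>A. rel_clique (topspace X) R A \<longrightarrow> finite A \<and> card A \<le> n))"

end

theory Submission
  imports Defs
begin

text \<open>
  If cliques are unbounded, list a clique with at least \<open>n + 1\<close> elements as the first
  entries of a point of \<open>X\<^sup>\<omega>\<close>, for each \<open>n\<close>. As \<open>R\<close> is closed, the coordinates
  of a cluster point of these points are pairwise \<open>R\<close>-related, so they form an infinite sequence.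
  If \<open>z\<close> is a cluster point of that sequence, then \<open>(z, z)\<close> lies in the closure of \<open>R\<close>,
  that is, in \<open>R\<close>, against irreflexivity.
\<close>

text \<open>If no point were a cluster point, every point would have an open neighbourhood missed by
  some tail of \<open>f\<close>. Sorting these neighbourhoods by where the tail starts gives a
  countable cover, and a finite subcover misses all late terms of \<open>f\<close>.\<close>

lemma countably_compact_space_cluster_point:
  assumes "countably_compact_space X" and f: "\<And>n::nat. f n \<in> topspace X"
  obtains z where "z \<in> topspace X"
    and "\<And>U. openin X U \<Longrightarrow> z \<in> U \<Longrightarrow> \<exists>\<^sub>\<infinity>n. f n \<in> U"
proof (rule ccontr)
  note cluster = that
  assume "\<not> thesis"
  have no_cluster: "\<exists>U. openin X U \<and> z \<in> U \<and> (\<exists>N. \<forall>n\<ge>N. f n \<notin> U)"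
    if "z \<in> topspace X" for z
  proof (rule ccontr)
    assume "\<not> ?thesis"
    then have "\<exists>\<^sub>\<infinity>n. f n \<in> U" if "openin X U" "z \<in> U" for U
      using that unfolding INFM_nat_le by blast
    with \<open>z \<in> topspace X\<close> have thesis
      by (rule cluster)
    with \<open>\<not> thesis\<close> show False ..
  qed
  \<comment> \<open>Merging all open sets that miss the tail from \<open>N\<close> on leaves one
    open set per \<open>N\<close>. This makes the cover countable, however many neighbourhoods were
    needed.\<close>
  define V where "V N = \<Union>{U. openin X U \<and> (\<forall>n\<ge>N. f n \<notin> U)}" for N
  have "topspace X \<subseteq> \<Union>(range V)"
  proof
    fix z
    assume "z \<in> topspace X"
    then obtain U N where "openin X U" "z \<in> U" "\<forall>n\<ge>N. f n \<notin> U"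
      using no_cluster by meson
    then have "z \<in> V N"
      unfolding V_def by blast
    then show "z \<in> \<Union>(range V)"
      by blast
  qed
  moreover have "\<forall>U\<in>range V. openin X U"
    unfolding V_def by (auto intro: openin_Union)
  moreover have "countable (range V)"
    by simp
  ultimately obtain \<F> where "finite \<F>" "\<F> \<subseteq> range V" and cover: "topspace X \<subseteq> \<Union>\<F>"
    using assms(1) unfolding countably_compact_space_def by meson
  then obtain I where "finite I" and I: "\<F> = V ` I"
    by (meson finite_subset_image)
  \<comment> \<open>The index \<open>M\<close> is at least every member of \<open>I\<close>, so
    \<open>f M\<close> belongs to each of the tails missed by the sets of the subcover.\<close>
  define M where "M = Max (insert 0 I)"
  have "f M \<in> \<Union>(V ` I)"
    using f cover I by blast
  then obtain N where "N \<in> I" "f M \<in> V N"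
    by blast
  moreover have "N \<le> M"
    using \<open>finite I\<close> \<open>N \<in> I\<close> by (simp add: M_def)
  ultimately show False
    unfolding V_def by blast
qed

lemma obtain_inj_on_atMost:
  assumes "\<not> (finite A \<and> card A \<le> n)"
  obtains h :: "nat \<Rightarrow> 'a" where "inj_on h {..n}" and "h ` {..n} \<subseteq> A"
proof -
  \<comment> \<open>Exactly \<open>Suc n\<close> elements are kept, one for each index in
    \<open>{..n}\<close>; this covers infinite \<open>A\<close> as well.\<close>
  obtain B where B: "B \<subseteq> A" "finite B" "card B = Suc n"
    using assms by (metis infinite_arbitrarily_large not_less_eq_eq obtain_subset_with_card_n)
  then obtain h where "bij_betw h {0..<Suc n} B"
    by (metis ex_bij_betw_nat_finite)
  then show thesis
    using B(1) that[of h] by (simp add: bij_betw_def atLeast0LessThan lessThan_Suc_atMost)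
qed

text \<open>Each condition on the limit involves only two coordinates \<open>i\<close> and
  \<open>j\<close>. Its failure is an open condition in the power, and \<open>f n\<close> satisfies
  the relation at these coordinates once \<open>n\<close> is at least
  \<open>max i j\<close>.\<close>

lemma cluster_point_sequence_pairwise:
  assumes "countably_compact_space (product_topology (\<lambda>_. X) (UNIV :: nat set))"
    and R: "closedin (prod_topology X X) R"
    and f: "\<And>n i :: nat. f n i \<in> topspace X"
    and rel: "\<And>n i j. i \<le> n \<Longrightarrow> j \<le> n \<Longrightarrow> i \<noteq> j \<Longrightarrow> (f n i, f n j) \<in> R"
  obtains y :: "nat \<Rightarrow> 'a"
  where "\<And>i. y i \<in> topspace X" and "\<And>i j. i \<noteq> j \<Longrightarrow> (y i, y j) \<in> R"
proof -
  let ?P = "product_topology (\<lambda>_. X) (UNIV :: nat set)"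
  have "f n \<in> topspace ?P" for n
    using f by (simp add: PiE_iff)
  then obtain y where y: "y \<in> topspace ?P"
    and cluster: "\<And>U. openin ?P U \<Longrightarrow> y \<in> U \<Longrightarrow> \<exists>\<^sub>\<infinity>n. f n \<in> U"
    using countably_compact_space_cluster_point[OF assms(1), of f] by blast
  show thesis
  proof
    show "y i \<in> topspace X" for i
      using y by (simp add: PiE_iff)
  next
    fix i j :: nat
    assume "i \<noteq> j"
    let ?F = "\<lambda>x :: nat \<Rightarrow> 'a. (x i, x j)"
    let ?U = "{x \<in> topspace ?P. ?F x \<in> topspace (prod_topology X X) - R}"
    have "continuous_map ?P (prod_topology X X) ?F"
      by (intro continuous_map_pairedI continuous_map_product_projection) auto
    then have "openin ?P ?U"
      using R by (intro openin_continuous_map_preimage) blast+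
    moreover have "f n \<notin> ?U" if "max i j \<le> n" for n
      using rel[of i n j] that \<open>i \<noteq> j\<close> by simp
    then have "\<not> (\<exists>\<^sub>\<infinity>n. f n \<in> ?U)"
      unfolding INFM_nat_le by blast
    ultimately have "y \<notin> ?U"
      using cluster by blast
    then show "(y i, y j) \<in> R"
      using y by (auto simp: PiE_iff)
  qed
qed

lemma no_closed_irrefl_pairwise_sequence:
  assumes "countably_compact_space X" "closedin (prod_topology X X) R" "irrefl R"
    and y: "\<And>i::nat. y i \<in> topspace X"
    and rel: "\<And>i j. i \<noteq> j \<Longrightarrow> (y i, y j) \<in> R"
  shows False
proof -
  obtain z where z: "z \<in> topspace X"
    and cluster: "\<And>U. openin X U \<Longrightarrow> z \<in> U \<Longrightarrow> \<exists>\<^sub>\<infinity>n. y n \<in> U"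
    by (rule countably_compact_space_cluster_point[OF assms(1), of y, OF y]) blast
  have "openin (prod_topology X X) (topspace X \<times> topspace X - R)"
    using assms(2) by (simp add: closedin_def)
  moreover have "(z, z) \<in> topspace X \<times> topspace X - R"
    using z \<open>irrefl R\<close> by (simp add: irrefl_def)
  ultimately obtain U V where UV: "openin X U" "openin X V" "z \<in> U" "z \<in> V"
    and disj: "U \<times> V \<subseteq> topspace X \<times> topspace X - R"
    unfolding openin_prod_topology_alt by meson
  \<comment> \<open>With the two sides of the box intersected, one neighbourhood of \<open>z\<close>
    serves both coordinates. Two visits at different indices then give a pair of \<open>R\<close>
    inside a box disjoint from \<open>R\<close>.\<close>
  have "\<exists>\<^sub>\<infinity>n. y n \<in> U \<inter> V"
    using UV by (intro cluster) auto
  then obtain n m where "y n \<in> U \<inter> V" "m > n" "y m \<in> U \<inter> V"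
    unfolding INFM_nat by metis
  then show False
    using rel[of n m] disj by auto
qed

text \<open>Open covers pull back along \<open>g\<close>, and surjectivity lets a finite subcover be
  pushed forward again. This transfers countable compactness from the power to \<open>X\<close>
  itself.\<close>

lemma countably_compact_space_continuous_image:
  assumes "countably_compact_space X" "continuous_map X Y g" "g ` topspace X = topspace Y"
  shows "countably_compact_space Y"
  unfolding countably_compact_space_def
proof (intro allI impI)
  fix \<U>
  assume \<U>: "countable \<U> \<and> (\<forall>U\<in>\<U>. openin Y U) \<and> topspace Y \<subseteq> \<Union>\<U>"
  let ?pre = "\<lambda>U. {x \<in> topspace X. g x \<in> U}"
  have "countable (?pre ` \<U>)" "\<forall>U\<in>?pre ` \<U>. openin X U"
    using \<U> assms(2) by (auto intro: openin_continuous_map_preimage)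
  moreover have "topspace X \<subseteq> \<Union>(?pre ` \<U>)"
  proof
    fix x
    assume "x \<in> topspace X"
    then have "g x \<in> topspace Y"
      unfolding assms(3)[symmetric] by (rule imageI)
    then have "g x \<in> \<Union>\<U>"
      using \<U> by blast
    then show "x \<in> \<Union>(?pre ` \<U>)"
      using \<open>x \<in> topspace X\<close> by auto
  qed
  ultimately obtain \<F> where "finite \<F>" "\<F> \<subseteq> ?pre ` \<U>" "topspace X \<subseteq> \<Union>\<F>"
    using assms(1) unfolding countably_compact_space_def by meson
  then obtain \<G> where "finite \<G>" "\<G> \<subseteq> \<U>" "\<F> = ?pre ` \<G>"
    by (meson finite_subset_image)
  moreover have "topspace Y \<subseteq> \<Union>\<G>"
    unfolding assms(3)[symmetric] using \<open>topspace X \<subseteq> \<Union>\<F>\<close> \<open>\<F> = ?pre ` \<G>\<close> by blast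
  ultimately show "\<exists>\<F>. finite \<F> \<and> \<F> \<subseteq> \<U> \<and> topspace Y \<subseteq> \<Union>\<F>"
    by blast
qed

theorem theorem1:
  fixes X :: "'a topology"
  assumes "countably_compact_space (product_topology (\<lambda>_. X) (UNIV :: nat set))"
  shows "bounded_cliques X"
  unfolding bounded_cliques_def
proof (intro allI impI, rule ccontr)
  fix R
  assume R: "closed_orthogonality_relation X R"
    and unbounded: "\<nexists>n. \<forall>A. rel_clique (topspace X) R A \<longrightarrow> finite A \<and> card A \<le> n"
  have closed: "closedin (prod_topology X X) R" and "irrefl R"
    using R by (auto simp: closed_orthogonality_relation_def orthogonality_relation_def)
  have "\<exists>h. inj_on h {..n} \<and> rel_clique (topspace X) R (h ` {..n})" for n :: nat
  proof -
    obtain A where A: "rel_clique (topspace X) R A" "\<not> (finite A \<and> card A \<le> n)"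
      using unbounded by blast
    then obtain h where "inj_on h {..n}" "h ` {..n} \<subseteq> A"
      using obtain_inj_on_atMost by blast
    moreover from this have "rel_clique (topspace X) R (h ` {..n})"
      using A(1) unfolding rel_clique_def by (meson order_trans pairwise_subset)
    ultimately show ?thesis
      by blast
  qed
  then have "\<exists>h. \<forall>n::nat. inj_on (h n) {..n} \<and> rel_clique (topspace X) R (h n ` {..n})"
    by (intro choice) blast
  then obtain h where inj: "\<And>n::nat. inj_on (h n) {..n}"
    and clique: "\<And>n. rel_clique (topspace X) R (h n ` {..n})"
    by blast
  \<comment> \<open>Beyond index \<open>n\<close> nothing is known about \<open>h n\<close>.
    Replacing \<open>i\<close> by \<open>min i n\<close> repeats the last clique element, which
    keeps the sequence in the power and changes no entry up to \<open>n\<close>.\<close>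
  have top: "h n (min i n) \<in> topspace X" for n i
    using clique[of n] by (auto simp: rel_clique_def)
  have related: "(h n i, h n j) \<in> R" if "i \<le> n" "j \<le> n" "i \<noteq> j" for n i j
  proof -
    have "h n i \<noteq> h n j"
      using inj_onD[OF inj[of n]] that by auto
    then show ?thesis
      using clique[of n] that by (auto simp: rel_clique_def pairwise_def)
  qed
  obtain y :: "nat \<Rightarrow> 'a" where y: "\<And>i. y i \<in> topspace X"
    and rel: "\<And>i j. i \<noteq> j \<Longrightarrow> (y i, y j) \<in> R"
  proof (rule cluster_point_sequence_pairwise[OF assms closed])
    show "h n (min i n) \<in> topspace X" for n i
      by (rule top)
    show "(h n (min i n), h n (min j n)) \<in> R" if "i \<le> n" "j \<le> n" "i \<noteq> j" for n i j
      using related that by (simp add: min_absorb1)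
  qed (rule that)
  let ?P = "product_topology (\<lambda>_. X) (UNIV :: nat set)"
  \<comment> \<open>The projection to coordinate 0 is onto because constant sequences lie in the
    power.\<close>
  have "(\<lambda>x. x 0) ` topspace ?P = topspace X"
  proof
    show "(\<lambda>x. x 0) ` topspace ?P \<subseteq> topspace X"
      by (auto simp: PiE_iff)
    show "topspace X \<subseteq> (\<lambda>x. x 0) ` topspace ?P"
    proof
      fix x
      assume "x \<in> topspace X"
      then have "(\<lambda>_. x) \<in> topspace ?P"
        by (simp add: PiE_iff)
      then show "x \<in> (\<lambda>x. x 0) ` topspace ?P"
        by (rule rev_image_eqI) simp
    qed
  qed
  moreover have "continuous_map ?P X (\<lambda>x. x 0)"
    by (rule continuous_map_product_projection) simp
  ultimately have "countably_compact_space X"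
    using countably_compact_space_continuous_image[OF assms] by simp
  then show False
    using closed \<open>irrefl R\<close> y rel by (rule no_closed_irrefl_pairwise_sequence)
qed

end
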